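(* Let $(\sigma,s)$ be a homothetic datum on an associative (not necessarily unital or commutative) $\mathbb{F}$-algebra $R$. Let $\alpha_R$ be an algebra endomorphism of $R$, $\delta_R$ an $\alpha_R$-skew derivation of $R$, and $w,e\in R$, such that $(\alpha_R,w;\delta_R,e,\mu(1)=0)$ is a $(\sigma,s)$-compatible skew derivation of type $1$, that is, for all $a\in R$, (i) $\alpha_R(s)-s=w^2+w\sigma+\sigma w-w$, (ii) $\alpha_R(a\sigma)=\alpha_R(a)\sigma+\alpha_R(a)w$, (iii) $\alpha_R(\sigma a)=\sigma\alpha_R(a)+w\alpha_R(a)$, (a) $\delta_R(s)=e\sigma+\sigma e+we-e$, (b) $\delta_R(a\sigma)=\delta_R(a)\sigma+\alpha_R(a)e$, (c) $\delta_R(\sigma a)=w\delta_R(a)+\sigma\delta_R(a)+ea$. Let $(\alpha_S,\delta_S)$ be the extension of these data to a skew derivation of the homothetic extension $R(\sigma,s)$, given by $\alpha_S(a+\xi\boldsymbol{\sigma})=\alpha_R(a)+\xi w+\xi\boldsymbol{\sigma}$ and $\delta_S(a+\xi\boldsymbol{\sigma})=\delta_R(a)+\xi e$, and let $(\tilde\sigma,s)$ be the induced homothetic datum on the Ore extension $R[x;\alpha_R,\delta_R]$ (defined in the context). Then there exists an algebra monomorphism $$\varphi:R[x;\alpha_R,\delta_R](\tilde\sigma,s)\longrightarrow R(\sigma,s)[x;\alpha_S,\delta_S]$$ rendering commutative the following diagram of algebra maps with exact rows: $$\begin{array}{ccccccccc} 0&\to& R[x;\alpha_R,\delta_R]&\xrightarrow{\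 \tilde\iota\ }& R[x;\alpha_R,\delta_R](\tilde\sigma,s)&\xrightarrow{\ \tilde\pi\ }&\mathbb{F}&\to&0\\ &&\Vert&&\downarrow{\scriptstyle\varphi}&&\downarrow{\scriptstyle j}&&\\ 0&\to& R[x;\alpha_R,\delta_R]&\xrightarrow{\ \iota'\ }& R(\sigma,s)[x;\alpha_S,\delta_S]&\xrightarrow{\ \pi'\ }&\mathbb{F}[x]&\to&0 \end{array}$$ that is, $\varphi\circ\tilde\iota=\iota'$ and $\pi'\circ\varphi=j\circ\tilde\pi$. Here $\tilde\iota(f)=f+0\tilde{\boldsymbol{\sigma}}$ and $\tilde\pi(f+\xi\tilde{\boldsymbol{\sigma}})=\xi$ are the canonical maps of the homothetic extension, $\iota'$ is the linear map with $\iota'(ax^n)=ax^n$, $\pi'$ is the linear map with $\pi'((a+\zeta\boldsymbol{\sigma})x^n)=\zeta x^n$, and $j:\mathbb{F}\to\mathbb{F}[x]$ is the inclusion of scalars.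
   Context: $\mathbb{F}$ denotes a field or the ring of integers $\mathbb{Z}$. Algebras are associative $\mathbb{F}$-algebras, not necessarily unital or commutative; algebra maps are $\mathbb{F}$-linear multiplicative maps (no unitality required). A double operator $\sigma=(\overleftarrow{\sigma},\overrightarrow{\sigma})$ on an algebra $A$ is a pair of $\mathbb{F}$-linear endomorphisms of $A$, written $\overrightarrow{\sigma}(a)=\sigma a$ and $\overleftarrow{\sigma}(a)=a\sigma$. It is a bimultiplication if $\sigma(ab)=(\sigma a)b$, $(ab)\sigma=a(b\sigma)$ and $a(\sigma b)=(a\sigma)b$ for all $a,b\in A$. A bimultiplication is a double homothetism if $\sigma(a\sigma)=(\sigma a)\sigma$ for all $a\in A$. A homothetic datum on $A$ is a pair $(\sigma,s)$ with $\sigma$ a double homothetism on $A$ and $s\in A$ such that $\sigma s=s\sigma$ and $\sigma^2=\sigma+\bar{s}$, i.e. $\sigma(\sigma a)=\sigma a+sa$ and $(a\sigma)\sigma=a\sigma+as$ for all $a\in A$. The homothetic extension $A(\sigma,s)$ is the $\mathbb{F}$-module $A\oplus\mathbb{F}$, whose elements $(a,\xi)$ are written $a+\xi\boldsymbol{\sigma}$ (with $\tilde{\boldsymbol{\sigma}}$ in place of $\boldsymbol{\sigma}$ for the datum $(\tilde\sigma,s)$), with the associative multiplication $$(a+\xi\boldsymbol{\sigma})(b+\zeta\boldsymbol{\sigma})=ab+\zeta\, a\sigma+\xi\,\sigma b+\xi\zeta s+\xi\zeta\boldsymbol{\sigma}.$$ For an algebra endomorphism $\alpha$ of $A$, an $\alpha$-skew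 derivation of $A$ is an $\mathbb{F}$-linear map $\delta:A\to A$ with $\delta(ab)=\delta(a)b+\alpha(a)\delta(b)$ for all $a,b\in A$. The Ore extension $A[x;\alpha,\delta]$ is the $\mathbb{F}$-module of polynomials $\sum_{i=0}^n a_ix^i$ with $a_i\in A$ (where $ax^0=a$), with the associative multiplication determined by $$(ax^m)(bx^n)=\sum_{i=0}^m a\,\Gamma[\alpha,\delta]^m_i(b)\,x^{n+i},\qquad m,n\ge 0,$$ where $\Gamma[\alpha,\delta]^m_i:A\to A$ is the sum of all possible compositions of $i$ copies of $\alpha$ with $m-i$ copies of $\delta$ (so $\Gamma[\alpha,\delta]^0_0=\mathrm{id}$). The homothetic datum $(\tilde\sigma,s)$ on $R[x;\alpha_R,\delta_R]$: let $p:R(\sigma,s)[x;\alpha_S,\delta_S]\to R[x;\alpha_R,\delta_R]$ be the linear map $(a+\zeta\boldsymbol{\sigma})x^n\mapsto ax^n$. The double operator $\tilde\sigma$ is defined by $$\tilde\sigma f=p(\boldsymbol{\sigma}\,\iota'(f)),\qquad f\tilde\sigma=p(\iota'(f)\,\boldsymbol{\sigma}),\qquad f\in R[x;\alpha_R,\delta_R],$$ with the products on the right-hand sides taken in $R(\sigma,s)[x;\alpha_S,\delta_S]$. The pair $(\tilde\sigma,s)$ is a homothetic datum on $R[x;\alpha_R,\delta_R]$, where $s\in R\subset R[x;\alpha_R,\delta_R]$. *)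

theory Defs
  imports
    "HOL-Computational_Algebra.Polynomial"
    "HOL-Library.Product_Plus"
begin

text \<open>
  An algebra is given by an explicit scalar action and an explicit multiplication on a type of
  class \<^class>\<open>ab_group_add\<close>. The multiplication is not the type-class one because the homothetic
  and Ore extensions put products depending on parameters on the types \<open>'a \<times> 'k\<close> and \<open>'a poly\<close>;
  of these types only the additive structure (and, for \<open>'a poly\<close>, the coefficients) is used.
\<close>

definition field_or_integers :: "'k::comm_ring_1 itself \<Rightarrow> bool" where
  "field_or_integers _ \<longleftrightarrow>
     (\<forall>x::'k. x \<noteq> 0 \<longrightarrow> (\<exists>y. x * y = 1)) \<or> bij (of_int :: int \<Rightarrow> 'k)"

locale assoc_algebra = module scale
  for scale :: "'k::comm_ring_1 \<Rightarrow> 'a::ab_group_add \<Rightarrow> 'a" (infixr \<open>*s\<close> 75) +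
  fixes mul :: "'a \<Rightarrow> 'a \<Rightarrow> 'a" (infixl \<open>\<bullet>\<close> 70)
  assumes mul_assoc: "(a \<bullet> b) \<bullet> c = a \<bullet> (b \<bullet> c)"
    and mul_add_left: "(a + b) \<bullet> c = a \<bullet> c + b \<bullet> c"
    and mul_add_right: "a \<bullet> (b + c) = a \<bullet> b + a \<bullet> c"
    and mul_scale_left: "(r *s a) \<bullet> b = r *s (a \<bullet> b)"
    and mul_scale_right: "a \<bullet> (r *s b) = r *s (a \<bullet> b)"

locale algebra_hom =
  A: assoc_algebra s1 m1 + B: assoc_algebra s2 m2 + module_hom s1 s2 f
  for s1 :: "'k::comm_ring_1 \<Rightarrow> 'a::ab_group_add \<Rightarrow> 'a" and m1
    and s2 :: "'k \<Rightarrow> 'b::ab_group_add \<Rightarrow> 'b" and m2 and f :: "'a \<Rightarrow> 'b" +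
  assumes hom_mul: "f (m1 a b) = m2 (f a) (f b)"

definition short_exact :: "('a::zero \<Rightarrow> 'b::zero) \<Rightarrow> ('b \<Rightarrow> 'c::zero) \<Rightarrow> bool" where
  "short_exact i q \<longleftrightarrow> inj i \<and> range i = {x. q x = 0} \<and> surj q"


subsection \<open>Homothetic data and homothetic extensions\<close>

text \<open>
  A double operator is the pair whose first component is \<open>a \<mapsto> a\<sigma>\<close> and whose second
  component is \<open>a \<mapsto> \<sigma>a\<close>.
\<close>

type_synonym 'a double_op = "('a \<Rightarrow> 'a) \<times> ('a \<Rightarrow> 'a)"

abbreviation right_op :: "'a \<Rightarrow> 'a double_op \<Rightarrow> 'a" (infixl \<open>\<lhd>\<close> 70) where
  "a \<lhd> \<sigma> \<equiv> fst \<sigma> a"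

abbreviation left_op :: "'a double_op \<Rightarrow> 'a \<Rightarrow> 'a" (infixr \<open>\<rhd>\<close> 70) where
  "\<sigma> \<rhd> a \<equiv> snd \<sigma> a"

context
  fixes scale :: "'k::comm_ring_1 \<Rightarrow> 'a::ab_group_add \<Rightarrow> 'a" (infixr \<open>*s\<close> 75)
    and mul :: "'a \<Rightarrow> 'a \<Rightarrow> 'a" (infixl \<open>\<bullet>\<close> 70)
begin

definition double_operator :: "'a double_op \<Rightarrow> bool" where
  "double_operator \<sigma> \<longleftrightarrow>
     module_hom scale scale (\<lambda>a. a \<lhd> \<sigma>) \<and> module_hom scale scale (\<lambda>a. \<sigma> \<rhd> a)"

definition bimultiplication :: "'a double_op \<Rightarrow> bool" where
  "bimultiplication \<sigma> \<longleftrightarrow> double_operator \<sigma> \<and>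
     (\<forall>a b. \<sigma> \<rhd> (a \<bullet> b) = (\<sigma> \<rhd> a) \<bullet> b) \<and>
     (\<forall>a b. (a \<bullet> b) \<lhd> \<sigma> = a \<bullet> (b \<lhd> \<sigma>)) \<and>
     (\<forall>a b. a \<bullet> (\<sigma> \<rhd> b) = (a \<lhd> \<sigma>) \<bullet> b)"

definition double_homothetism :: "'a double_op \<Rightarrow> bool" where
  "double_homothetism \<sigma> \<longleftrightarrow> bimultiplication \<sigma> \<and> (\<forall>a. \<sigma> \<rhd> (a \<lhd> \<sigma>) = (\<sigma> \<rhd> a) \<lhd> \<sigma>)"

definition homothetic_datum :: "'a double_op \<Rightarrow> 'a \<Rightarrow> bool" where
  "homothetic_datum \<sigma> s \<longleftrightarrow> double_homothetism \<sigma> \<and> \<sigma> \<rhd> s = s \<lhd> \<sigma> \<and>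
     (\<forall>a. \<sigma> \<rhd> (\<sigma> \<rhd> a) = \<sigma> \<rhd> a + s \<bullet> a) \<and>
     (\<forall>a. (a \<lhd> \<sigma>) \<lhd> \<sigma> = a \<lhd> \<sigma> + a \<bullet> s)"

text \<open>The pair \<open>(a, \<xi>)\<close> stands for \<open>a + \<xi>\<sigma>\<close>; in particular \<open>(0, 1)\<close> is the element \<open>\<sigma>\<close>.\<close>

definition hext_scale :: "'k \<Rightarrow> 'a \<times> 'k \<Rightarrow> 'a \<times> 'k" where
  "hext_scale c u = (c *s fst u, c * snd u)"

definition hext_mul :: "'a double_op \<Rightarrow> 'a \<Rightarrow> 'a \<times> 'k \<Rightarrow> 'a \<times> 'k \<Rightarrow> 'a \<times> 'k" where
  "hext_mul \<sigma> s u v = (case (u, v) of ((a, \<xi>), (b, \<zeta>)) \<Rightarrow>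
     (a \<bullet> b + \<zeta> *s (a \<lhd> \<sigma>) + \<xi> *s (\<sigma> \<rhd> b) + (\<xi> * \<zeta>) *s s, \<xi> * \<zeta>))"

end

definition hext_incl :: "'a \<Rightarrow> 'a \<times> 'k::zero" where
  "hext_incl a = (a, 0)"

definition hext_proj :: "'a \<times> 'k \<Rightarrow> 'k" where
  "hext_proj u = snd u"


subsection \<open>Skew derivations and Ore extensions\<close>

text \<open>
  The sum runs over the \<open>m choose i\<close> words of length \<open>m\<close> in two letters, with \<open>True\<close> standing for
  \<open>\<alpha>\<close> and \<open>False\<close> for \<open>\<delta>\<close>, so that words inducing equal compositions are counted separately.
\<close>

definition ore_Gamma ::
    "('a \<Rightarrow> 'a) \<Rightarrow> ('a \<Rightarrow> 'a) \<Rightarrow> nat \<Rightarrow> nat \<Rightarrow> 'a \<Rightarrow> 'a::comm_monoid_add" where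
  "ore_Gamma \<alpha> \<delta> m i a =
     (\<Sum>w \<in> {w :: bool list. length w = m \<and> count_list w True = i}.
        foldr (\<lambda>c. if c then \<alpha> else \<delta>) w a)"

definition ore_scale :: "('k \<Rightarrow> 'a \<Rightarrow> 'a) \<Rightarrow> 'k \<Rightarrow> 'a poly \<Rightarrow> 'a::zero poly" where
  "ore_scale scale c f = map_poly (scale c) f"

context
  fixes scale :: "'k::comm_ring_1 \<Rightarrow> 'a::ab_group_add \<Rightarrow> 'a" (infixr \<open>*s\<close> 75)
    and mul :: "'a \<Rightarrow> 'a \<Rightarrow> 'a" (infixl \<open>\<bullet>\<close> 70)
begin

definition skew_derivation :: "('a \<Rightarrow> 'a) \<Rightarrow> ('a \<Rightarrow> 'a) \<Rightarrow> bool" where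
  "skew_derivation \<alpha> \<delta> \<longleftrightarrow> module_hom scale scale \<delta> \<and>
     (\<forall>a b. \<delta> (a \<bullet> b) = \<delta> a \<bullet> b + \<alpha> a \<bullet> \<delta> b)"

text \<open>
  The bi-additive extension of
  \<open>(a x\<^sup>m)(b x\<^sup>n) = \<Sum>i\<le>m. a \<Gamma>[\<alpha>,\<delta>]\<^sup>m\<^sub>i(b) x\<^sup>n\<^sup>+\<^sup>i\<close>.
\<close>

definition ore_mul :: "('a \<Rightarrow> 'a) \<Rightarrow> ('a \<Rightarrow> 'a) \<Rightarrow> 'a poly \<Rightarrow> 'a poly \<Rightarrow> 'a poly" where
  "ore_mul \<alpha> \<delta> f g =
     (\<Sum>m\<le>degree f. \<Sum>n\<le>degree g. \<Sum>i\<le>m.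
        monom (coeff f m \<bullet> ore_Gamma \<alpha> \<delta> m i (coeff g n)) (n + i))"


subsection \<open>Compatible skew derivations of type 1\<close>

text \<open>
  The entry \<open>\<mu>\<close> of the data \<open>(\<alpha>, w; \<delta>, e, \<mu>)\<close>, with \<open>\<mu>(1) = 0\<close>, contributes nothing to
  the conditions.
\<close>

definition compatible_type1 ::
    "'a double_op \<Rightarrow> 'a \<Rightarrow> ('a \<Rightarrow> 'a) \<Rightarrow> 'a \<Rightarrow> ('a \<Rightarrow> 'a) \<Rightarrow> 'a \<Rightarrow> bool" where
  "compatible_type1 \<sigma> s \<alpha> w \<delta> e \<longleftrightarrow>
     \<alpha> s - s = w \<bullet> w + w \<lhd> \<sigma> + \<sigma> \<rhd> w - w \<and>
     (\<forall>a. \<alpha> (a \<lhd> \<sigma>) = \<alpha> a \<lhd> \<sigma> + \<alpha> a \<bullet> w) \<and>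
     (\<forall>a. \<alpha> (\<sigma> \<rhd> a) = \<sigma> \<rhd> \<alpha> a + w \<bullet> \<alpha> a) \<and>
     \<delta> s = e \<lhd> \<sigma> + \<sigma> \<rhd> e + w \<bullet> e - e \<and>
     (\<forall>a. \<delta> (a \<lhd> \<sigma>) = \<delta> a \<lhd> \<sigma> + \<alpha> a \<bullet> e) \<and>
     (\<forall>a. \<delta> (\<sigma> \<rhd> a) = w \<bullet> \<delta> a + \<sigma> \<rhd> \<delta> a + e \<bullet> a)"

definition ext_endo :: "('a \<Rightarrow> 'a) \<Rightarrow> 'a \<Rightarrow> 'a \<times> 'k \<Rightarrow> 'a \<times> 'k" where
  "ext_endo \<alpha> w u = (case u of (a, \<xi>) \<Rightarrow> (\<alpha> a + \<xi> *s w, \<xi>))"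

definition ext_deriv :: "('a \<Rightarrow> 'a) \<Rightarrow> 'a \<Rightarrow> 'a \<times> 'k \<Rightarrow> 'a \<times> 'k" where
  "ext_deriv \<delta> e u = (case u of (a, \<xi>) \<Rightarrow> (\<delta> a + \<xi> *s e, 0))"

end


subsection \<open>The induced homothetic datum on the Ore extension\<close>

definition ore_incl :: "'a::zero poly \<Rightarrow> ('a \<times> 'k::zero) poly" where
  "ore_incl f = map_poly (\<lambda>a. (a, 0)) f"

definition ore_proj :: "('a::zero \<times> 'k::zero) poly \<Rightarrow> 'k poly" where
  "ore_proj g = map_poly snd g"

definition ore_drop :: "('a::zero \<times> 'k::zero) poly \<Rightarrow> 'a poly" where
  "ore_drop g = map_poly fst g"

text \<open>
  The argument \<open>mulS\<close> is the multiplication of \<open>R(\<sigma>,s)[x;\<alpha>\<^sub>S,\<delta>\<^sub>S]\<close>, in which \<open>\<sigma>\<close> is the constant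
  polynomial \<open>[:(0, 1):]\<close>.
\<close>

definition induced_op ::
    "(('a::zero \<times> 'k::zero_neq_one) poly \<Rightarrow> ('a \<times> 'k) poly \<Rightarrow> ('a \<times> 'k) poly) \<Rightarrow> 'a poly double_op"
  where
  "induced_op mulS =
     (\<lambda>f. ore_drop (mulS (ore_incl f) [:(0, 1):]),
      \<lambda>f. ore_drop (mulS [:(0, 1):] (ore_incl f)))"

end

theory Submission
  imports Defs
begin

text \<open>
  Inside \<open>R(\<sigma>,s)[x;\<alpha>\<^sub>S,\<delta>\<^sub>S]\<close> consider the constant polynomial \<open>T = \<sigma>\<close> and the image \<open>I\<close> of
  \<open>R[x;\<alpha>\<^sub>R,\<delta>\<^sub>R]\<close>. As the kernel of a homomorphism onto the polynomial ring over the scalars, \<open>I\<close> is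
  an ideal, and \<open>T T = s + T\<close>, so the sum of \<open>I\<close> and the scalar multiples of \<open>T\<close> is a subalgebra.
  Its multiplication table is that of the homothetic extension of \<open>R[x;\<alpha>\<^sub>R,\<delta>\<^sub>R]\<close> by the induced
  datum, because that datum consists of the left and right multiplications by \<open>T\<close> on \<open>I\<close>. Therefore
  the map \<open>\<phi>\<close> sending \<open>(f, \<xi>)\<close> to \<open>f + \<xi> T\<close> is multiplicative. It is injective since the projection
  recovers \<open>\<xi>\<close>, and the algebra laws of its domain are inherited from its codomain along \<open>\<phi>\<close>
  (\<open>assoc_algebra_if_embeds\<close>).

  What remains is that Ore extensions are associative algebras, functorially in the coefficients
  (\<open>assoc_algebra_ore\<close>, \<open>algebra_hom_ore\<close>). Let \<open>X\<close> be the operator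
  \<open>b x\<^sup>n \<mapsto> \<alpha>(b) x\<^sup>n\<^sup>+\<^sup>1 + \<delta>(b) x\<^sup>n\<close> and \<open>L\<^sub>a\<close> the coefficientwise left multiplication by \<open>a\<close>.
  The recursion for the functions \<open>\<Gamma>\<close> turns the product into \<open>f g = \<Sum>m. L\<^sub>a X\<^sup>m g\<close> with \<open>a\<close> the
  \<open>m\<close>th coefficient of \<open>f\<close>, and the skew Leibniz rule becomes \<open>X L\<^sub>a = L\<^sub>b X + L\<^sub>c\<close> with
  \<open>b = \<alpha>(a)\<close> and \<open>c = \<delta>(a)\<close>. It follows that \<open>X (f g) = (X f) g\<close>, which gives associativity.

  The conditions on compatible data of type 1 enter only through the fact that \<open>\<alpha>\<^sub>S\<close> is an
  endomorphism of \<open>R(\<sigma>,s)\<close> and \<open>\<delta>\<^sub>S\<close> a skew derivation for it (\<open>ore_setting_hext\<close>).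
\<close>

section \<open>Algebra homomorphisms and transport of algebra laws\<close>

lemma assoc_algebraI:
  assumes "module s"
    and "\<And>a b c. m (m a b) c = m a (m b c)"
    and "\<And>a b c. m (a + b) c = m a c + m b c"
    and "\<And>a b c. m a (b + c) = m a b + m a c"
    and "\<And>r a b. m (s r a) b = s r (m a b)"
    and "\<And>r a b. m a (s r b) = s r (m a b)"
  shows "assoc_algebra s m"
  using assms by (simp add: assoc_algebra_def assoc_algebra_axioms_def)

lemma algebra_homI:
  assumes "assoc_algebra s1 m1" "assoc_algebra s2 m2"
    and "\<And>a b. f (a + b) = f a + f b"
    and "\<And>r a. f (s1 r a) = s2 r (f a)"
    and "\<And>a b. f (m1 a b) = m2 (f a) (f b)"
  shows "algebra_hom s1 m1 s2 m2 f"
  using assms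
  by (simp add: algebra_hom_def algebra_hom_axioms_def module_hom_def module_hom_axioms_def
      assoc_algebra.axioms(1))

lemma algebra_hom_additive:
  assumes "algebra_hom s1 m1 s2 m2 f"
  shows "additive f"
proof -
  interpret algebra_hom s1 m1 s2 m2 f by fact
  show ?thesis by (simp add: additive_def add)
qed

text \<open>
  An identity holds in the source of an injective map as soon as it holds in the target. This makes
  the homothetic extension of \<open>R[x;\<alpha>\<^sub>R,\<delta>\<^sub>R]\<close> an algebra once \<open>\<phi>\<close> is known to respect the operations.
\<close>

lemma assoc_algebra_if_embeds:
  fixes s1 :: "'k::comm_ring_1 \<Rightarrow> 'a::ab_group_add \<Rightarrow> 'a"
  assumes "assoc_algebra s2 m2" and "inj f"
    and add: "\<And>a b. f (a + b) = f a + f b"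
    and scale: "\<And>r a. f (s1 r a) = s2 r (f a)"
    and mul: "\<And>a b. f (m1 a b) = m2 (f a) (f b)"
  shows "assoc_algebra s1 m1"
proof -
  interpret B: assoc_algebra s2 m2 by fact
  have eqI: "a = b" if "f a = f b" for a b
    using that \<open>inj f\<close> by (simp add: inj_eq)
  show ?thesis
  proof (rule assoc_algebraI)
    show "module s1"
      by standard (auto intro!: eqI simp: add scale B.scale_left_distrib B.scale_right_distrib)
  qed (auto intro!: eqI simp: add scale mul B.mul_assoc B.mul_add_left B.mul_add_right
      B.mul_scale_left B.mul_scale_right)
qed


section \<open>Coefficientwise maps and the functions \<open>\<Gamma>\<close>\<close>

lemma coeff_map_poly_additive:
  assumes "additive h"
  shows "coeff (map_poly h f) n = h (coeff f n)"
  using additive.zero[OF assms] by (rule coeff_map_poly)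

lemma degree_map_poly_additive:
  assumes "additive h"
  shows "degree (map_poly h f) \<le> degree f"
  by (rule degree_le) (simp add: coeff_map_poly_additive[OF assms] additive.zero[OF assms] coeff_eq_0)

lemma additive_map_poly:
  assumes "additive h"
  shows "additive (map_poly h)"
  using assms by (auto simp: additive_def poly_eq_iff coeff_map_poly_additive)

lemma additive_funpow:
  fixes h :: "'a::ab_group_add \<Rightarrow> 'a"
  assumes "additive h"
  shows "additive (h ^^ n)"
  using assms by (induction n) (auto simp: additive_def)

lemma ore_Gamma_0: "ore_Gamma \<alpha> \<delta> 0 i a = (if i = 0 then a else 0)"
proof -
  have "{w :: bool list. length w = 0 \<and> count_list w True = i} = (if i = 0 then {[]} else {})"
    by auto
  then show ?thesis by (simp add: ore_Gamma_def)
qed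

lemma ore_Gamma_eq_0:
  assumes "m < i"
  shows "ore_Gamma \<alpha> \<delta> m i a = 0"
proof -
  have "length w \<noteq> m \<or> count_list w True \<noteq> i" for w
    using assms count_le_length[of w True] by auto
  then have "{w :: bool list. length w = m \<and> count_list w True = i} = {}"
    by blast
  then show ?thesis by (simp only: ore_Gamma_def sum.empty)
qed

text \<open>
  Splitting a word at its first letter, which is the outermost map of the composition, gives
  Pascal's recursion.
\<close>

lemma ore_Gamma_Suc:
  fixes \<alpha> \<delta> :: "'a::ab_group_add \<Rightarrow> 'a"
  assumes "additive \<alpha>" "additive \<delta>"
  shows "ore_Gamma \<alpha> \<delta> (Suc m) i a =
    (case i of 0 \<Rightarrow> 0 | Suc j \<Rightarrow> \<alpha> (ore_Gamma \<alpha> \<delta> m j a)) + \<delta> (ore_Gamma \<alpha> \<delta> m i a)"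
proof -
  define W where "W m i = {w :: bool list. length w = m \<and> count_list w True = i}" for m i
  have fin: "finite (W m i)" for m i
    by (rule finite_subset[OF _ finite_lists_length_eq[of "UNIV :: bool set" m]])
      (auto simp: W_def)
  have split: "W (Suc m) i =
      (case i of 0 \<Rightarrow> {} | Suc j \<Rightarrow> Cons True ` W m j) \<union> Cons False ` W m i"
  proof (rule set_eqI)
    fix w
    show "w \<in> W (Suc m) i \<longleftrightarrow>
      w \<in> (case i of 0 \<Rightarrow> {} | Suc j \<Rightarrow> Cons True ` W m j) \<union> Cons False ` W m i"
    proof (cases w)
      case Nil
      then show ?thesis by (auto simp: W_def split: nat.splits)
    next
      case (Cons c v)
      then show ?thesis by (cases c) (auto simp: W_def split: nat.splits)
    qed
  qed
  show ?thesis
    unfolding ore_Gamma_def W_def[symmetric] split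
    by (subst sum.union_disjoint)
      (auto simp: fin sum.reindex additive.sum[OF assms(1)] additive.sum[OF assms(2)]
        split: nat.splits)
qed


section \<open>Ore extensions as algebras\<close>

locale ore_setting = assoc_algebra scale mul
  for scale :: "'k::comm_ring_1 \<Rightarrow> 'a::ab_group_add \<Rightarrow> 'a" (infixr \<open>*s\<close> 75)
    and mul :: "'a \<Rightarrow> 'a \<Rightarrow> 'a" (infixl \<open>\<bullet>\<close> 70) +
  fixes \<alpha> \<delta> :: "'a \<Rightarrow> 'a"
  assumes endo: "algebra_hom scale mul scale mul \<alpha>"
    and deriv: "skew_derivation scale mul \<alpha> \<delta>"
begin

sublocale \<alpha>: algebra_hom scale mul scale mul \<alpha>
  by (rule endo)

sublocale \<delta>: module_hom scale scale \<delta>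
  using deriv by (simp add: skew_derivation_def)

lemma deriv_mul: "\<delta> (a \<bullet> b) = \<delta> a \<bullet> b + \<alpha> a \<bullet> \<delta> b"
  using deriv by (simp add: skew_derivation_def)

lemma additive_endo: "additive \<alpha>"
  and additive_deriv: "additive \<delta>"
  and additive_mul: "additive (mul a)"
  and additive_scale: "additive (scale r)"
  by (simp_all add: additive_def \<alpha>.add \<delta>.add mul_add_right scale_right_distrib)

lemma mul_zero_left [simp]: "0 \<bullet> a = 0"
  and mul_zero_right [simp]: "a \<bullet> 0 = 0"
  using mul_add_left[of 0 0 a] mul_add_right[of a 0 0] by simp_all

lemmas coeff_map_simps =
  coeff_map_poly_additive[OF additive_endo] coeff_map_poly_additive[OF additive_deriv]
  coeff_map_poly_additive[OF additive_mul] coeff_map_poly_additive[OF additive_scale]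

abbreviation lmul :: "'a \<Rightarrow> 'a poly \<Rightarrow> 'a poly" where
  "lmul a \<equiv> map_poly (mul a)"

text \<open>
  Left multiplication by the indeterminate, which is an operator even though \<open>x\<close> itself need not
  be an element of the possibly non-unital Ore extension.
\<close>

definition xmul :: "'a poly \<Rightarrow> 'a poly" where
  "xmul g = pCons 0 (map_poly \<alpha> g) + map_poly \<delta> g"

abbreviation omul :: "'a poly \<Rightarrow> 'a poly \<Rightarrow> 'a poly" where
  "omul \<equiv> ore_mul mul \<alpha> \<delta>"

lemma coeff_xmul:
  "coeff (xmul g) n = (case n of 0 \<Rightarrow> 0 | Suc k \<Rightarrow> \<alpha> (coeff g k)) + \<delta> (coeff g n)"
  by (simp add: xmul_def coeff_map_simps coeff_pCons split: nat.split)

lemma additive_lmul: "additive (lmul a)"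
  by (rule additive_map_poly[OF additive_mul])

lemma additive_xmul: "additive xmul"
  by (auto simp: additive_def poly_eq_iff coeff_xmul \<alpha>.add \<delta>.add split: nat.splits)

lemma additive_xmul_funpow: "additive (xmul ^^ m)"
  by (rule additive_funpow[OF additive_xmul])

lemma lmul_0 [simp]: "lmul 0 f = 0"
  by (simp add: poly_eq_iff coeff_map_simps)

lemma lmul_add: "lmul (a + b) f = lmul a f + lmul b f"
  by (simp add: poly_eq_iff coeff_map_simps mul_add_left)

lemma lmul_mul: "lmul (a \<bullet> b) f = lmul a (lmul b f)"
  by (simp add: poly_eq_iff coeff_map_simps mul_assoc)

lemma lmul_monom: "lmul a (monom b n) = monom (a \<bullet> b) n"
  by (simp add: map_poly_monom)

text \<open>The commutation rule \<open>x a = \<alpha>(a) x + \<delta>(a)\<close>, read as an identity between operators.\<close>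

lemma xmul_lmul: "xmul (lmul a g) = lmul (\<alpha> a) (xmul g) + lmul (\<delta> a) g"
  by (simp add: poly_eq_iff coeff_xmul coeff_map_simps deriv_mul \<alpha>.hom_mul mul_add_right
      split: nat.split)

lemma xmul_monom: "xmul (monom b n) = monom (\<alpha> b) (Suc n) + monom (\<delta> b) n"
  by (auto simp: poly_eq_iff coeff_xmul coeff_monom split: nat.split)

lemma xmul_funpow_monom:
  "(xmul ^^ m) (monom b n) = (\<Sum>i\<le>m. monom (ore_Gamma \<alpha> \<delta> m i b) (n + i))"
proof (induction m)
  case 0
  show ?case by (simp add: ore_Gamma_0)
next
  case (Suc m)
  let ?G = "\<lambda>i. ore_Gamma \<alpha> \<delta> m i b"
  have "(xmul ^^ Suc m) (monom b n) =
      (\<Sum>i\<le>m. monom (\<alpha> (?G i)) (n + Suc i)) + (\<Sum>i\<le>m. monom (\<delta> (?G i)) (n + i))"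
    by (simp add: Suc additive.sum[OF additive_xmul] xmul_monom sum.distrib)
  also have "(\<Sum>i\<le>m. monom (\<delta> (?G i)) (n + i)) = (\<Sum>i\<le>Suc m. monom (\<delta> (?G i)) (n + i))"
    by (simp add: ore_Gamma_eq_0)
  also have "(\<Sum>i\<le>m. monom (\<alpha> (?G i)) (n + Suc i)) =
      (\<Sum>i\<le>Suc m. monom (case i of 0 \<Rightarrow> 0 | Suc j \<Rightarrow> \<alpha> (?G j)) (n + i))"
    by (subst sum.atMost_Suc_shift) simp
  also have "\<dots> + (\<Sum>i\<le>Suc m. monom (\<delta> (?G i)) (n + i)) =
      (\<Sum>i\<le>Suc m. monom (ore_Gamma \<alpha> \<delta> (Suc m) i b) (n + i))"
    by (simp only: sum.distrib[symmetric] add_monom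
        ore_Gamma_Suc[OF additive_endo additive_deriv])
  finally show ?case .
qed

text \<open>
  The product is left multiplication by \<open>f\<close> with \<open>x\<close> read as the operator \<open>xmul\<close>.
  All algebra laws are derived from this form, in which the sums over words have disappeared.
\<close>

lemma omul_eq_degree: "omul f g = (\<Sum>m\<le>degree f. lmul (coeff f m) ((xmul ^^ m) g))"
proof -
  have "(xmul ^^ m) g =
      (\<Sum>n\<le>degree g. \<Sum>i\<le>m. monom (ore_Gamma \<alpha> \<delta> m i (coeff g n)) (n + i))" for m
    by (subst poly_as_sum_of_monoms[of g, symmetric])
      (simp only: additive.sum[OF additive_xmul_funpow] xmul_funpow_monom)
  then show ?thesis
    by (simp add: ore_mul_def additive.sum[OF additive_lmul] lmul_monom)
qed

lemma omul_eq:
  assumes "degree f \<le> N"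
  shows "omul f g = (\<Sum>m\<le>N. lmul (coeff f m) ((xmul ^^ m) g))"
  unfolding omul_eq_degree using assms
  by (intro sum.mono_neutral_left) (auto simp: coeff_eq_0)

lemma omul_add_right: "omul f (g + h) = omul f g + omul f h"
  by (simp add: omul_eq_degree additive.add[OF additive_xmul_funpow] additive.add[OF additive_lmul]
      sum.distrib)

lemma omul_add_left: "omul (f + g) h = omul f h + omul g h"
proof -
  let ?N = "max (degree f) (degree g)"
  have "degree (f + g) \<le> ?N" by (simp add: degree_add_le)
  then show ?thesis
    by (simp add: omul_eq[of _ ?N] lmul_add sum.distrib)
qed

lemma omul_lmul: "omul (lmul a f) g = lmul a (omul f g)"
proof -
  have "degree (lmul a f) \<le> degree f"
    by (rule degree_map_poly_additive[OF additive_mul])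
  then show ?thesis
    by (simp add: omul_eq[of _ "degree f"] coeff_map_simps lmul_mul additive.sum[OF additive_lmul])
qed

lemma omul_xmul: "omul (xmul f) g = xmul (omul f g)"
proof -
  let ?N = "degree f"
  let ?P = "\<lambda>m. (xmul ^^ m) g"
  have deg: "degree (xmul f) \<le> Suc ?N"
    by (rule degree_le) (auto simp: coeff_xmul coeff_eq_0 split: nat.split)
  have "omul (xmul f) g = (\<Sum>m\<le>Suc ?N.
      lmul (case m of 0 \<Rightarrow> 0 | Suc k \<Rightarrow> \<alpha> (coeff f k)) (?P m) + lmul (\<delta> (coeff f m)) (?P m))"
    by (simp only: omul_eq[OF deg] coeff_xmul lmul_add)
  also have "\<dots> = (\<Sum>m\<le>Suc ?N. lmul (case m of 0 \<Rightarrow> 0 | Suc k \<Rightarrow> \<alpha> (coeff f k)) (?P m)) +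
      (\<Sum>m\<le>Suc ?N. lmul (\<delta> (coeff f m)) (?P m))"
    by (rule sum.distrib)
  also have "(\<Sum>m\<le>Suc ?N. lmul (case m of 0 \<Rightarrow> 0 | Suc k \<Rightarrow> \<alpha> (coeff f k)) (?P m)) =
      (\<Sum>m\<le>?N. lmul (\<alpha> (coeff f m)) (xmul (?P m)))"
    by (subst sum.atMost_Suc_shift) simp
  also have "(\<Sum>m\<le>Suc ?N. lmul (\<delta> (coeff f m)) (?P m)) = (\<Sum>m\<le>?N. lmul (\<delta> (coeff f m)) (?P m))"
    by (simp add: coeff_eq_0)
  also have "(\<Sum>m\<le>?N. lmul (\<alpha> (coeff f m)) (xmul (?P m))) + \<dots> = xmul (omul f g)"
    by (simp add: omul_eq_degree additive.sum[OF additive_xmul] xmul_lmul sum.distrib)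
  finally show ?thesis .
qed

lemma omul_xmul_funpow: "omul ((xmul ^^ m) f) g = (xmul ^^ m) (omul f g)"
  by (induction m) (simp_all add: omul_xmul)

text \<open>
  Right multiplication by \<open>h\<close> commutes with the operators \<open>lmul a\<close> and \<open>xmul\<close> out of which left
  multiplication by \<open>f\<close> is built.
\<close>

lemma omul_assoc: "omul (omul f g) h = omul f (omul g h)"
proof -
  have add: "additive (\<lambda>f. omul f h)"
    by (simp add: additive_def omul_add_left)
  have "omul (omul f g) h = (\<Sum>m\<le>degree f. omul (lmul (coeff f m) ((xmul ^^ m) g)) h)"
    by (simp only: omul_eq_degree[of f g] additive.sum[OF add])
  then show ?thesis
    by (simp add: omul_lmul omul_xmul_funpow omul_eq_degree[of f "omul g h"])
qed

lemma coeff_ore_scale: "coeff (ore_scale scale r f) n = r *s coeff f n"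
  by (simp add: ore_scale_def coeff_map_simps)

lemma additive_ore_scale: "additive (ore_scale scale r)"
  by (simp add: additive_def poly_eq_iff coeff_ore_scale scale_right_distrib)

lemma lmul_scale: "lmul (r *s a) f = ore_scale scale r (lmul a f)"
  by (simp add: poly_eq_iff coeff_map_simps coeff_ore_scale mul_scale_left)

lemma lmul_ore_scale: "lmul a (ore_scale scale r f) = ore_scale scale r (lmul a f)"
  by (simp add: poly_eq_iff coeff_map_simps coeff_ore_scale mul_scale_right)

lemma xmul_funpow_ore_scale:
  "(xmul ^^ m) (ore_scale scale r f) = ore_scale scale r ((xmul ^^ m) f)"
proof (induction m)
  case (Suc m)
  have "xmul (ore_scale scale r g) = ore_scale scale r (xmul g)" for g
    by (auto simp: poly_eq_iff coeff_xmul coeff_ore_scale \<alpha>.scale \<delta>.scale scale_right_distrib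
        split: nat.split)
  with Suc show ?case by simp
qed simp

lemma omul_scale_left: "omul (ore_scale scale r f) g = ore_scale scale r (omul f g)"
proof -
  have "degree (ore_scale scale r f) \<le> degree f"
    unfolding ore_scale_def by (rule degree_map_poly_additive[OF additive_scale])
  then show ?thesis
    by (simp add: omul_eq[of _ "degree f"] coeff_ore_scale lmul_scale
        additive.sum[OF additive_ore_scale])
qed

lemma omul_scale_right: "omul f (ore_scale scale r g) = ore_scale scale r (omul f g)"
  by (simp add: omul_eq_degree xmul_funpow_ore_scale lmul_ore_scale
      additive.sum[OF additive_ore_scale])

lemma module_ore_scale: "module (ore_scale scale)"
  by (simp add: module_def poly_eq_iff coeff_ore_scale scale_right_distrib scale_left_distrib)

lemma assoc_algebra_ore: "assoc_algebra (ore_scale scale) omul"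
  by (rule assoc_algebraI)
    (fact module_ore_scale omul_assoc omul_add_left omul_add_right omul_scale_left omul_scale_right)+

lemma omul_const: "omul [:a:] [:b:] = [:a \<bullet> b:]"
  by (simp add: omul_eq_degree map_poly_pCons)

end

text \<open>
  Ore extensions are functorial, because a homomorphism compatible with the skew derivations
  intertwines the operators \<open>lmul a\<close> and \<open>xmul\<close> of its source and target. The inclusion and the
  projection in the second row of the diagram are both obtained in this way.
\<close>

lemma algebra_hom_ore:
  assumes "ore_setting s1 m1 \<alpha>1 \<delta>1" and "ore_setting s2 m2 \<alpha>2 \<delta>2"
    and hom: "algebra_hom s1 m1 s2 m2 h"
    and \<alpha>: "\<And>a. h (\<alpha>1 a) = \<alpha>2 (h a)" and \<delta>: "\<And>a. h (\<delta>1 a) = \<delta>2 (h a)"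
  shows "algebra_hom (ore_scale s1) (ore_mul m1 \<alpha>1 \<delta>1) (ore_scale s2) (ore_mul m2 \<alpha>2 \<delta>2)
    (map_poly h)"
proof -
  interpret A: ore_setting s1 m1 \<alpha>1 \<delta>1 by fact
  interpret B: ore_setting s2 m2 \<alpha>2 \<delta>2 by fact
  interpret h: algebra_hom s1 m1 s2 m2 h by fact
  note additive_h = algebra_hom_additive[OF hom]
  note coeff_h = coeff_map_poly_additive[OF additive_h]
  have lmul: "map_poly h (A.lmul a f) = B.lmul (h a) (map_poly h f)" for a f
    by (simp add: poly_eq_iff coeff_h A.coeff_map_simps B.coeff_map_simps h.hom_mul)
  have "map_poly h (A.xmul f) = B.xmul (map_poly h f)" for f
    by (auto simp: poly_eq_iff coeff_h A.coeff_xmul B.coeff_xmul h.add \<alpha> \<delta> split: nat.split)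
  then have xmul: "map_poly h ((A.xmul ^^ n) f) = (B.xmul ^^ n) (map_poly h f)" for n f
    by (induction n) simp_all
  show ?thesis
  proof (rule algebra_homI[OF A.assoc_algebra_ore B.assoc_algebra_ore])
    fix f g r
    show "map_poly h (f + g) = map_poly h f + map_poly h g"
      by (rule additive.add[OF additive_map_poly[OF additive_h]])
    show "map_poly h (ore_scale s1 r f) = ore_scale s2 r (map_poly h f)"
      by (simp add: poly_eq_iff coeff_h A.coeff_ore_scale B.coeff_ore_scale h.scale)
    have "degree (map_poly h f) \<le> degree f"
      by (rule degree_map_poly_additive[OF additive_h])
    then show "map_poly h (A.omul f g) = B.omul (map_poly h f) (map_poly h g)"
      by (simp add: A.omul_eq_degree B.omul_eq coeff_h lmul xmul
          additive.sum[OF additive_map_poly[OF additive_h]])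
  qed
qed

lemma assoc_algebra_times: "assoc_algebra (*) ((*) :: 'k::comm_ring_1 \<Rightarrow> 'k \<Rightarrow> 'k)"
  by (rule assoc_algebraI) (auto simp: module_def algebra_simps)

lemma assoc_algebra_poly: "assoc_algebra smult ((*) :: 'k::comm_ring_1 poly \<Rightarrow> 'k poly \<Rightarrow> 'k poly)"
  by (rule assoc_algebraI) (auto simp: module_def smult_add_right smult_add_left algebra_simps)

text \<open>
  The polynomial ring over the scalars is an Ore extension too, which makes the projection onto it
  accessible to functoriality.
\<close>

lemma ore_setting_trivial: "ore_setting (*) ((*) :: 'k::comm_ring_1 \<Rightarrow> 'k \<Rightarrow> 'k) (\<lambda>a. a) (\<lambda>_. 0)"
proof (intro ore_setting.intro ore_setting_axioms.intro assoc_algebra_times)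
  show "algebra_hom (*) (*) (*) ((*) :: 'k \<Rightarrow> 'k \<Rightarrow> 'k) (\<lambda>a. a)"
    by (rule algebra_homI[OF assoc_algebra_times assoc_algebra_times]) simp_all
  show "skew_derivation (*) ((*) :: 'k \<Rightarrow> 'k \<Rightarrow> 'k) (\<lambda>a. a) (\<lambda>_. 0)"
    by (simp add: skew_derivation_def module_hom_def module_hom_axioms_def
        assoc_algebra.axioms(1)[OF assoc_algebra_times])
qed

lemma ore_scale_trivial: "ore_scale (*) = (smult :: 'k::comm_ring_1 \<Rightarrow> 'k poly \<Rightarrow> 'k poly)"
  by (intro ext) (simp add: poly_eq_iff ore_scale_def coeff_map_poly)

lemma ore_mul_trivial:
  "ore_mul (*) (\<lambda>a. a) (\<lambda>_. 0) = ((*) :: 'k::comm_ring_1 poly \<Rightarrow> 'k poly \<Rightarrow> 'k poly)"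
proof (intro ext)
  fix f g :: "'k poly"
  let ?X = "ore_setting.xmul (\<lambda>a. a) (\<lambda>_. 0) :: 'k poly \<Rightarrow> 'k poly"
  have "?X p = pCons 0 p" for p
    by (simp add: poly_eq_iff ore_setting.coeff_xmul[OF ore_setting_trivial] coeff_pCons
        split: nat.split)
  then have xmul: "(?X ^^ n) g = monom 1 n * g" for n
    by (induction n) (simp_all add: monom_Suc)
  have lmul: "map_poly ((*) a) p = smult a p" for a :: 'k and p
    by (simp add: poly_eq_iff coeff_map_poly)
  have "smult a (monom 1 n * g) = monom a n * g" for a n
    by (simp only: mult_smult_left[symmetric] smult_monom mult_1_right)
  then have "ore_mul (*) (\<lambda>a. a) (\<lambda>_. 0) f g = (\<Sum>m\<le>degree f. monom (coeff f m) m * g)"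
    by (simp only: ore_setting.omul_eq_degree[OF ore_setting_trivial] xmul lmul)
  also have "\<dots> = (\<Sum>m\<le>degree f. monom (coeff f m) m) * g"
    by (rule sum_distrib_right[symmetric])
  also have "\<dots> = f * g"
    by (simp only: poly_as_sum_of_monoms)
  finally show "ore_mul (*) (\<lambda>a. a) (\<lambda>_. 0) f g = f * g" .
qed


section \<open>Skew derivations of the homothetic extension\<close>

locale homothetic_setting = assoc_algebra scale mul
  for scale :: "'k::comm_ring_1 \<Rightarrow> 'a::ab_group_add \<Rightarrow> 'a" (infixr \<open>*s\<close> 75)
    and mul :: "'a \<Rightarrow> 'a \<Rightarrow> 'a" (infixl \<open>\<bullet>\<close> 70) +
  fixes \<sigma> :: "'a double_op" and s :: 'a
  assumes datum: "homothetic_datum scale mul \<sigma> s"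
begin

sublocale r: module_hom scale scale "fst \<sigma>"
  using datum by (simp add: homothetic_datum_def double_homothetism_def bimultiplication_def
      double_operator_def)

sublocale l: module_hom scale scale "snd \<sigma>"
  using datum by (simp add: homothetic_datum_def double_homothetism_def bimultiplication_def
      double_operator_def)

lemma op_simps:
  "\<sigma> \<rhd> (a \<bullet> b) = (\<sigma> \<rhd> a) \<bullet> b"
  "(a \<bullet> b) \<lhd> \<sigma> = a \<bullet> (b \<lhd> \<sigma>)"
  "a \<bullet> (\<sigma> \<rhd> b) = (a \<lhd> \<sigma>) \<bullet> b"
  "\<sigma> \<rhd> (a \<lhd> \<sigma>) = (\<sigma> \<rhd> a) \<lhd> \<sigma>"
  "\<sigma> \<rhd> s = s \<lhd> \<sigma>"
  "\<sigma> \<rhd> (\<sigma> \<rhd> a) = \<sigma> \<rhd> a + s \<bullet> a"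
  "(a \<lhd> \<sigma>) \<lhd> \<sigma> = a \<lhd> \<sigma> + a \<bullet> s"
  using datum by (simp_all add: homothetic_datum_def double_homothetism_def bimultiplication_def)

lemmas linear_simps =
  scale_right_distrib scale_left_distrib mul_add_left mul_add_right mul_scale_left mul_scale_right
  r.add r.scale l.add l.scale

lemma hext_mul_simps:
  "hext_mul scale mul \<sigma> s (a, \<xi>) (b, \<zeta>) =
    (a \<bullet> b + \<zeta> *s (a \<lhd> \<sigma>) + \<xi> *s (\<sigma> \<rhd> b) + (\<xi> * \<zeta>) *s s, \<xi> * \<zeta>)"
  by (simp add: hext_mul_def)

lemma hext_scale_simps: "hext_scale scale c (a, \<xi>) = (c *s a, c * \<xi>)"
  by (simp add: hext_scale_def)

lemma assoc_algebra_hext: "assoc_algebra (hext_scale scale) (hext_mul scale mul \<sigma> s)"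
proof (rule assoc_algebraI)
  show "module (hext_scale scale)"
    by standard (auto simp: hext_scale_simps linear_simps algebra_simps)
qed (auto simp: hext_scale_simps hext_mul_simps linear_simps op_simps mul_assoc algebra_simps)

lemma algebra_hom_hext_incl:
  "algebra_hom scale mul (hext_scale scale) (hext_mul scale mul \<sigma> s) (\<lambda>a. (a, 0))"
  by (rule algebra_homI[OF assoc_algebra_axioms assoc_algebra_hext])
    (simp_all add: hext_scale_simps hext_mul_simps)

lemma algebra_hom_hext_snd:
  "algebra_hom (hext_scale scale) (hext_mul scale mul \<sigma> s) (*) (*) snd"
  by (rule algebra_homI[OF assoc_algebra_hext assoc_algebra_times])
    (auto simp: hext_scale_simps hext_mul_simps)

text \<open>
  The first three compatibility conditions say exactly that the extension of \<open>\<alpha>\<close> respects the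
  products \<open>\<sigma>\<sigma>\<close>, \<open>a\<sigma>\<close> and \<open>\<sigma>a\<close>; the last three say the same for the skew Leibniz rule.
\<close>

lemma ore_setting_hext:
  assumes "ore_setting scale mul \<alpha> \<delta>" and comp: "compatible_type1 mul \<sigma> s \<alpha> w \<delta> e"
  shows "ore_setting (hext_scale scale) (hext_mul scale mul \<sigma> s)
    (ext_endo scale \<alpha> w) (ext_deriv scale \<delta> e)"
proof -
  interpret R: ore_setting scale mul \<alpha> \<delta> by fact
  interpret H: assoc_algebra "hext_scale scale" "hext_mul scale mul \<sigma> s"
    by (rule assoc_algebra_hext)
  have \<alpha>s: "\<alpha> s = s + w \<bullet> w + w \<lhd> \<sigma> + \<sigma> \<rhd> w - w"
    and \<delta>s: "\<delta> s = e \<lhd> \<sigma> + \<sigma> \<rhd> e + w \<bullet> e - e"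
    using comp by (simp_all add: compatible_type1_def algebra_simps)
  have comp': "\<alpha> (a \<lhd> \<sigma>) = \<alpha> a \<lhd> \<sigma> + \<alpha> a \<bullet> w" "\<alpha> (\<sigma> \<rhd> a) = \<sigma> \<rhd> \<alpha> a + w \<bullet> \<alpha> a"
    "\<delta> (a \<lhd> \<sigma>) = \<delta> a \<lhd> \<sigma> + \<alpha> a \<bullet> e" "\<delta> (\<sigma> \<rhd> a) = w \<bullet> \<delta> a + \<sigma> \<rhd> \<delta> a + e \<bullet> a" for a
    using comp by (simp_all add: compatible_type1_def)
  have endo: "algebra_hom (hext_scale scale) (hext_mul scale mul \<sigma> s)
      (hext_scale scale) (hext_mul scale mul \<sigma> s) (ext_endo scale \<alpha> w)"
    by (rule algebra_homI[OF assoc_algebra_hext assoc_algebra_hext])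
      (auto simp: ext_endo_def hext_scale_simps hext_mul_simps linear_simps R.\<alpha>.add R.\<alpha>.scale
        R.\<alpha>.hom_mul comp' \<alpha>s scale_right_diff_distrib algebra_simps)
  have deriv: "skew_derivation (hext_scale scale) (hext_mul scale mul \<sigma> s)
      (ext_endo scale \<alpha> w) (ext_deriv scale \<delta> e)"
    unfolding skew_derivation_def module_hom_def module_hom_axioms_def
    by (auto simp: H.module_axioms ext_endo_def ext_deriv_def hext_scale_simps hext_mul_simps
        linear_simps R.\<delta>.add R.\<delta>.scale R.deriv_mul comp' \<delta>s scale_right_diff_distrib algebra_simps)
  show ?thesis
    by (intro ore_setting.intro ore_setting_axioms.intro assoc_algebra_hext endo deriv)
qed

end


section \<open>The second row of the diagram\<close>

lemma coeff_ore_incl: "coeff (ore_incl f) n = (coeff f n, 0)"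
  by (simp add: ore_incl_def coeff_map_poly zero_prod_def)

lemma coeff_ore_proj: "coeff (ore_proj f) n = snd (coeff f n)"
  by (simp add: ore_proj_def coeff_map_poly)

lemma coeff_ore_drop: "coeff (ore_drop f) n = fst (coeff f n)"
  by (simp add: ore_drop_def coeff_map_poly)

lemma ore_incl_ore_drop:
  assumes "ore_proj g = 0"
  shows "ore_incl (ore_drop g) = g"
  using assms by (auto simp: poly_eq_iff coeff_ore_incl coeff_ore_drop coeff_ore_proj prod_eq_iff)

lemma ore_incl_const: "ore_incl [:a:] = [:(a, 0):]"
  by (simp add: poly_eq_iff coeff_ore_incl coeff_pCons zero_prod_def split: nat.split)

lemma ore_proj_ore_incl: "ore_proj (ore_incl f) = 0"
  by (simp add: poly_eq_iff coeff_ore_proj coeff_ore_incl)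

lemma short_exact_ore: "short_exact (ore_incl :: 'a::zero poly \<Rightarrow> ('a \<times> 'k::zero) poly) ore_proj"
  unfolding short_exact_def
proof (intro conjI)
  show "inj (ore_incl :: 'a poly \<Rightarrow> ('a \<times> 'k) poly)"
    by (rule injI) (simp add: poly_eq_iff coeff_ore_incl)
  show "range (ore_incl :: 'a poly \<Rightarrow> ('a \<times> 'k) poly) = {g. ore_proj g = 0}"
    by (auto simp: ore_proj_ore_incl) (metis ore_incl_ore_drop rangeI)
  show "surj (ore_proj :: ('a \<times> 'k) poly \<Rightarrow> 'k poly)"
  proof (rule surjI)
    show "ore_proj (map_poly (\<lambda>c. (0, c)) p) = p" for p :: "'k poly"
      by (simp add: poly_eq_iff coeff_ore_proj coeff_map_poly zero_prod_def)
  qed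
qed

lemma short_exact_hext: "short_exact (hext_incl :: 'a::zero \<Rightarrow> 'a \<times> 'k::zero) hext_proj"
  by (auto simp: short_exact_def hext_incl_def hext_proj_def inj_def surj_def image_iff)


section \<open>The comparison map\<close>

theorem proposition3p3:
  fixes scale :: "'k::comm_ring_1 \<Rightarrow> 'a::ab_group_add \<Rightarrow> 'a"
    and mul :: "'a \<Rightarrow> 'a \<Rightarrow> 'a"
    and \<sigma> :: "'a double_op"
    and s w e :: 'a
    and \<alpha>R \<delta>R :: "'a \<Rightarrow> 'a"
  defines "\<alpha>S \<equiv> ext_endo scale \<alpha>R w"
    and "\<delta>S \<equiv> ext_deriv scale \<delta>R e"
  defines "scaleRx \<equiv> ore_scale scale"
    and "mulRx \<equiv> ore_mul mul \<alpha>R \<delta>R"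
    and "scaleSx \<equiv> ore_scale (hext_scale scale)"
    and "mulSx \<equiv> ore_mul (hext_mul scale mul \<sigma> s) \<alpha>S \<delta>S"
  defines "\<sigma>t \<equiv> induced_op mulSx"
  defines "scaleT \<equiv> hext_scale scaleRx"
    and "mulT \<equiv> hext_mul scaleRx mulRx \<sigma>t [:s:]"
  assumes "field_or_integers TYPE('k)"
    and "assoc_algebra scale mul"
    and "homothetic_datum scale mul \<sigma> s"
    and "algebra_hom scale mul scale mul \<alpha>R"
    and "skew_derivation scale mul \<alpha>R \<delta>R"
    and "compatible_type1 mul \<sigma> s \<alpha>R w \<delta>R e"
  shows "\<exists>\<phi> :: 'a poly \<times> 'k \<Rightarrow> ('a \<times> 'k) poly.
     algebra_hom scaleT mulT scaleSx mulSx \<phi> \<and> inj \<phi> \<and>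
     algebra_hom scaleRx mulRx scaleT mulT hext_incl \<and>
     algebra_hom scaleT mulT (*) (*) (hext_proj :: 'a poly \<times> 'k \<Rightarrow> 'k) \<and>
     algebra_hom scaleRx mulRx scaleSx mulSx ore_incl \<and>
     algebra_hom scaleSx mulSx smult (*) (ore_proj :: ('a \<times> 'k) poly \<Rightarrow> 'k poly) \<and>
     algebra_hom (*) (*) smult (*) (\<lambda>c::'k. [:c:]) \<and>
     short_exact (hext_incl :: 'a poly \<Rightarrow> 'a poly \<times> 'k) hext_proj \<and>
     short_exact (ore_incl :: 'a poly \<Rightarrow> ('a \<times> 'k) poly) ore_proj \<and>
     \<phi> \<circ> hext_incl = ore_incl \<and>
     ore_proj \<circ> \<phi> = (\<lambda>c. [:c:]) \<circ> hext_proj"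
proof -
  interpret R: ore_setting scale mul \<alpha>R \<delta>R
    using assms(11,13,14) by (simp add: ore_setting_def ore_setting_axioms_def)
  interpret H: homothetic_setting scale mul \<sigma> s
    using assms(11,12) by (simp add: homothetic_setting_def homothetic_setting_axioms_def)
  interpret S: ore_setting "hext_scale scale" "hext_mul scale mul \<sigma> s" \<alpha>S \<delta>S
    unfolding \<alpha>S_def \<delta>S_def
    using R.ore_setting_axioms assms(15) by (rule H.ore_setting_hext)
  interpret Rx: assoc_algebra scaleRx mulRx
    unfolding scaleRx_def mulRx_def by (rule R.assoc_algebra_ore)
  interpret Sx: assoc_algebra scaleSx mulSx
    unfolding scaleSx_def mulSx_def by (rule S.assoc_algebra_ore)

  have incl: "algebra_hom scaleRx mulRx scaleSx mulSx ore_incl"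
    unfolding scaleRx_def mulRx_def scaleSx_def mulSx_def ore_incl_def[abs_def]
    by (rule algebra_hom_ore[OF R.ore_setting_axioms S.ore_setting_axioms H.algebra_hom_hext_incl])
      (simp_all add: \<alpha>S_def \<delta>S_def ext_endo_def ext_deriv_def)
  have proj: "algebra_hom scaleSx mulSx smult (*) (ore_proj :: ('a \<times> 'k) poly \<Rightarrow> 'k poly)"
    unfolding scaleSx_def mulSx_def ore_proj_def[abs_def] ore_scale_trivial[symmetric]
      ore_mul_trivial[symmetric]
    by (rule algebra_hom_ore[OF S.ore_setting_axioms ore_setting_trivial H.algebra_hom_hext_snd])
      (auto simp: \<alpha>S_def \<delta>S_def ext_endo_def ext_deriv_def)
  interpret incl: algebra_hom scaleRx mulRx scaleSx mulSx ore_incl by (rule incl)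
  interpret proj: algebra_hom scaleSx mulSx smult "(*)" "ore_proj :: ('a \<times> 'k) poly \<Rightarrow> 'k poly"
    by (rule proj)

  define T :: "('a \<times> 'k) poly" where "T = [:(0, 1):]"
  have scale_T: "scaleSx c T = [:(0, c):]" for c
    by (simp add: poly_eq_iff scaleSx_def S.coeff_ore_scale T_def coeff_pCons H.hext_scale_simps
        zero_prod_def split: nat.split)
  have T_T: "mulSx T T = ore_incl [:s:] + T"
    by (simp add: T_def mulSx_def S.omul_const H.hext_mul_simps ore_incl_const)
  \<comment> \<open>The image of \<open>ore_incl\<close> is the kernel of \<open>ore_proj\<close>, hence an ideal: no information is lost
    when the induced double operator drops the component along \<open>\<sigma>\<close>.\<close>
  have left_T: "ore_incl (\<sigma>t \<rhd> f) = mulSx T (ore_incl f)"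
    and right_T: "ore_incl (f \<lhd> \<sigma>t) = mulSx (ore_incl f) T" for f
    by (simp_all add: \<sigma>t_def induced_op_def T_def[symmetric] ore_incl_ore_drop proj.hom_mul
        ore_proj_ore_incl)

  define \<phi> :: "'a poly \<times> 'k \<Rightarrow> ('a \<times> 'k) poly"
    where "\<phi> u = ore_incl (fst u) + scaleSx (snd u) T" for u
  have \<phi>_add: "\<phi> (u + v) = \<phi> u + \<phi> v" for u v
    by (simp add: \<phi>_def incl.add Sx.scale_left_distrib)
  have \<phi>_scale: "\<phi> (scaleT c u) = scaleSx c (\<phi> u)" for c u
    by (simp add: \<phi>_def scaleT_def hext_scale_def incl.scale Sx.scale_right_distrib)
  have \<phi>_mul: "\<phi> (mulT u v) = mulSx (\<phi> u) (\<phi> v)" for u v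
    by (cases u; cases v)
      (simp add: \<phi>_def mulT_def hext_mul_def incl.add incl.scale incl.hom_mul left_T right_T T_T
        Sx.mul_add_left Sx.mul_add_right Sx.mul_scale_left Sx.mul_scale_right
        Sx.scale_right_distrib algebra_simps)
  have proj_\<phi>: "ore_proj (\<phi> u) = [:snd u:]" for u
    by (simp add: \<phi>_def proj.add ore_proj_ore_incl scale_T)
      (simp add: ore_proj_def map_poly_pCons)
  have "inj \<phi>"
  proof (rule injI)
    fix u v
    assume eq: "\<phi> u = \<phi> v"
    then have "snd u = snd v"
      using proj_\<phi>[of u] proj_\<phi>[of v] by simp
    moreover from this eq have "fst u = fst v"
      by (simp add: \<phi>_def poly_eq_iff coeff_ore_incl)
    ultimately show "u = v" by (simp add: prod_eq_iff)
  qed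
  with Sx.assoc_algebra_axioms have T: "assoc_algebra scaleT mulT"
    by (rule assoc_algebra_if_embeds) (fact \<phi>_add \<phi>_scale \<phi>_mul)+

  have "algebra_hom scaleT mulT scaleSx mulSx \<phi>"
    by (rule algebra_homI[OF T Sx.assoc_algebra_axioms]) (fact \<phi>_add \<phi>_scale \<phi>_mul)+
  moreover have "algebra_hom scaleRx mulRx scaleT mulT hext_incl"
    by (rule algebra_homI[OF Rx.assoc_algebra_axioms T])
      (simp_all add: hext_incl_def scaleT_def mulT_def hext_scale_def hext_mul_def)
  moreover have "algebra_hom scaleT mulT (*) (*) (hext_proj :: 'a poly \<times> 'k \<Rightarrow> 'k)"
    by (rule algebra_homI[OF T assoc_algebra_times])
      (auto simp: hext_proj_def scaleT_def mulT_def hext_scale_def hext_mul_def)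
  moreover have "algebra_hom (*) (*) smult (*) (\<lambda>c::'k. [:c:])"
    by (rule algebra_homI[OF assoc_algebra_times assoc_algebra_poly]) simp_all
  moreover have "\<phi> \<circ> hext_incl = ore_incl"
    by (simp add: fun_eq_iff \<phi>_def hext_incl_def)
  moreover have "ore_proj \<circ> \<phi> = (\<lambda>c. [:c:]) \<circ> hext_proj"
    by (simp add: fun_eq_iff proj_\<phi> hext_proj_def)
  ultimately show ?thesis
    using \<open>inj \<phi>\<close> incl proj short_exact_hext short_exact_ore by blast
qed

end
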